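(* Let $n\geq 4$. The graph $Q_n$ is a connected vertex-transitive CIS graph of order $4n$ and valency $7$ with $\alpha(Q_n)=n$ and $\omega(Q_n)=4$. Moreover, if $n$ is prime then $Q_n$ is not a Cayley graph.
   Context: All graphs are finite, simple and undirected. For $n\geq 3$, $Q_n$ is the graph with vertex set $\mathbb{Z}_n\times\mathbb{Z}_2\times\mathbb{Z}_2$ whose edges are: all pairs $\{(i,x,y),(i+1,y,z)\}$ with $i\in\mathbb{Z}_n$, $x,y,z\in\mathbb{Z}_2$; and all pairs $\{(i,x,y),(i,u,v)\}$ with $i\in\mathbb{Z}_n$, $x,y,u,v\in\mathbb{Z}_2$, $(x,y)\neq(u,v)$. A clique (respectively, stable set) is a set of pairwise adjacent (respectively, pairwise non-adjacent) vertices; "maximal" means maximal with respect to inclusion. $\omega(\Gamma)$ and $\alpha(\Gamma)$ denote the largest cardinality of a clique and of a stable set of $\Gamma$. A graph is CIS if every maximal stable set and every maximal clique have non-empty intersection. A graph has valency $k$ if every vertex has exactly $k$ neighbors. A graph is vertex-transitive if for every pair of vertices there is an automorphism mapping one to the other. For a group $G$ and an inverse-closed subset $S\subseteq G$ with $1\notin S$, the Cayley graph of $G$ with connection set $S$ has vertex set $G$, with $g,h$ adjacent if and only if $g^{-1}h\in S$; a graph is Cayley if it is isomorphic to some such graph. *)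

theory Defs
  imports
    "Graph_Theory.Graph_Theory"
    "HOL-Algebra.Group"
    "HOL-Computational_Algebra.Primes"
begin

text \<open>
  Finite simple undirected graphs are the \<^const>\<open>pair_graph\<close>s of the graph library: an edge
  \<open>{u, v}\<close> is represented by the two arcs \<open>(u, v)\<close> and \<open>(v, u)\<close>. Connectedness and isomorphism
  are the library's \<^const>\<open>Digraph_Component.connected\<close> and \<^const>\<open>digraph_iso\<close>.
\<close>

definition is_clique :: "'a pair_pre_digraph \<Rightarrow> 'a set \<Rightarrow> bool" where
  "is_clique \<Gamma> K \<longleftrightarrow> K \<subseteq> pverts \<Gamma> \<and> (\<forall>u\<in>K. \<forall>v\<in>K. u \<noteq> v \<longrightarrow> (u, v) \<in> parcs \<Gamma>)"

definition is_stable_set :: "'a pair_pre_digraph \<Rightarrow> 'a set \<Rightarrow> bool" where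
  "is_stable_set \<Gamma> S \<longleftrightarrow> S \<subseteq> pverts \<Gamma> \<and> (\<forall>u\<in>S. \<forall>v\<in>S. (u, v) \<notin> parcs \<Gamma>)"

definition is_maximal_clique :: "'a pair_pre_digraph \<Rightarrow> 'a set \<Rightarrow> bool" where
  "is_maximal_clique \<Gamma> K \<longleftrightarrow>
     is_clique \<Gamma> K \<and> (\<forall>K'. is_clique \<Gamma> K' \<and> K \<subseteq> K' \<longrightarrow> K' = K)"

definition is_maximal_stable_set :: "'a pair_pre_digraph \<Rightarrow> 'a set \<Rightarrow> bool" where
  "is_maximal_stable_set \<Gamma> S \<longleftrightarrow>
     is_stable_set \<Gamma> S \<and> (\<forall>S'. is_stable_set \<Gamma> S' \<and> S \<subseteq> S' \<longrightarrow> S' = S)"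

definition clique_number :: "'a pair_pre_digraph \<Rightarrow> nat" where
  "clique_number \<Gamma> = Max (card ` {K. is_clique \<Gamma> K})"

definition stability_number :: "'a pair_pre_digraph \<Rightarrow> nat" where
  "stability_number \<Gamma> = Max (card ` {S. is_stable_set \<Gamma> S})"

definition is_CIS :: "'a pair_pre_digraph \<Rightarrow> bool" where
  "is_CIS \<Gamma> \<longleftrightarrow>
     (\<forall>S K. is_maximal_stable_set \<Gamma> S \<and> is_maximal_clique \<Gamma> K \<longrightarrow> S \<inter> K \<noteq> {})"

definition has_valency :: "'a pair_pre_digraph \<Rightarrow> nat \<Rightarrow> bool" where
  "has_valency \<Gamma> k \<longleftrightarrow> (\<forall>v\<in>pverts \<Gamma>. card {w \<in> pverts \<Gamma>. (v, w) \<in> parcs \<Gamma>} = k)"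

definition is_vertex_transitive :: "'a pair_pre_digraph \<Rightarrow> bool" where
  "is_vertex_transitive \<Gamma> \<longleftrightarrow>
     (\<forall>u\<in>pverts \<Gamma>. \<forall>v\<in>pverts \<Gamma>.
        \<exists>f. pre_digraph.digraph_isomorphism (with_proj \<Gamma>) f
          \<and> app_iso f (with_proj \<Gamma>) = with_proj \<Gamma>
          \<and> iso_verts f u = v)"

definition cayley_graph :: "'g monoid \<Rightarrow> 'g set \<Rightarrow> 'g pair_pre_digraph" where
  "cayley_graph G S =
     \<lparr> pverts = carrier G,
       parcs = {(g, h). g \<in> carrier G \<and> h \<in> carrier G \<and> inv\<^bsub>G\<^esub> g \<otimes>\<^bsub>G\<^esub> h \<in> S} \<rparr>"

text \<open>
  HOL cannot quantify over types inside a definition, so the type \<open>'g\<close> carrying the group is a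
  parameter; a theorem with \<open>'g\<close> left as a free type variable covers groups over all types.
\<close>

definition is_cayley :: "'g itself \<Rightarrow> 'a pair_pre_digraph \<Rightarrow> bool" where
  "is_cayley (_ :: 'g itself) \<Gamma> \<longleftrightarrow>
     (\<exists>(G :: 'g monoid) S. group G \<and> S \<subseteq> carrier G \<and> (\<forall>s\<in>S. inv\<^bsub>G\<^esub> s \<in> S) \<and> \<one>\<^bsub>G\<^esub> \<notin> S
        \<and> digraph_iso (with_proj \<Gamma>) (with_proj (cayley_graph G S)))"

text \<open>\<open>\<int>\<^sub>n\<close> is represented by \<open>{..<n}\<close> with addition modulo \<open>n\<close>.\<close>

definition Q_edges :: "nat \<Rightarrow> (nat \<times> nat \<times> nat) set set" where
  "Q_edges n =
     {{(i, x, y), ((i + 1) mod n, y, z)} | i x y z. i < n \<and> x < 2 \<and> y < 2 \<and> z < 2} \<union>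
     {{(i, x, y), (i, u, v)} | i x y u v.
        i < n \<and> x < 2 \<and> y < 2 \<and> u < 2 \<and> v < 2 \<and> (x, y) \<noteq> (u, v)}"

definition Q :: "nat \<Rightarrow> (nat \<times> nat \<times> nat) pair_pre_digraph" where
  "Q n = \<lparr> pverts = {..<n} \<times> {..<2} \<times> {..<2}, parcs = {(a, b). {a, b} \<in> Q_edges n} \<rparr>"

lemma Q_pair_graph:
  assumes "n \<ge> 3"
  shows "pair_graph (Q n)"
proof -
  have wf: "a \<in> pverts (Q n) \<and> b \<in> pverts (Q n)" if "(a, b) \<in> parcs (Q n)" for a b
  proof -
    have "{a, b} \<in> Q_edges n"
      using that by (simp add: Q_def)
    moreover have "e \<subseteq> pverts (Q n)" if "e \<in> Q_edges n" for e
      using that assms unfolding Q_def Q_edges_def by auto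
    ultimately have "{a, b} \<subseteq> pverts (Q n)" by blast
    then show ?thesis by simp
  qed
  have eq: "p = q" if "{a} = {p, q}" for a p q :: "nat \<times> nat \<times> nat"
    using that by blast
  have irr: "(a, a) \<notin> parcs (Q n)" for a
  proof
    assume "(a, a) \<in> parcs (Q n)"
    then have "{a} \<in> Q_edges n" by (simp add: Q_def)
    then consider (1) i x y z where "i < n" "{a} = {(i, x, y), ((i + 1) mod n, y, z)}"
      | (2) i x y u v where "(x, y) \<noteq> (u, v)" "{a} = {(i, x, y), (i, u, v)}"
      unfolding Q_edges_def by blast
    then show False
    proof cases
      case 1
      have "(i + 1) mod n = i" using eq[OF 1(2)] by simp
      then show False using 1(1) assms by (cases "i + 1 = n") auto
    next
      case 2
      then show False using eq[OF 2(2)] by simp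
    qed
  qed
  have fin: "finite (pverts (Q n))" by (simp add: Q_def)
  have "finite (parcs (Q n))"
    by (rule finite_subset[of _ "pverts (Q n) \<times> pverts (Q n)"]) (use wf fin in auto)
  moreover have "symmetric (with_proj (Q n))"
    by (simp add: symmetric_def sym_def Q_def insert_commute)
  ultimately show ?thesis
    using wf irr fin by unfold_locales (auto simp del: with_proj_simps)
qed

lemma cayley_graph_bidirected:
  fixes G (structure)
  assumes "group G" "S \<subseteq> carrier G" "\<forall>s\<in>S. inv s \<in> S" "\<one> \<notin> S"
  shows "pair_bidirected_digraph (cayley_graph G S)"
proof -
  interpret group G by fact
  have "inv h \<otimes> g \<in> S" if "g \<in> carrier G" "h \<in> carrier G" "inv g \<otimes> h \<in> S" for g h
    using assms(3) that by (metis inv_closed inv_inv inv_mult_group)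
  then show ?thesis
    using assms(4) by unfold_locales (auto simp: cayley_graph_def symmetric_def sym_def)
qed

end

theory Submission
  imports Defs "HOL-Algebra.Sylow" "HOL-Algebra.Group_Action" "HOL-Algebra.Elementary_Groups"
begin

text \<open>
  The maximal cliques of \<open>Q n\<close> are the layers \<open>{i} \<times> \<int>\<^sub>2 \<times> \<int>\<^sub>2\<close> and, for every \<open>i\<close> and \<open>y\<close>, the
  junctions \<open>{(i, x, y)} \<union> {(i + 1, y, z)}\<close>. A stable set has at most one vertex in each layer, so
  the stable vertices of the two neighbouring layers cannot block a whole layer; hence a maximal
  stable set meets every layer. Its vertices \<open>(i, a, b)\<close> and \<open>(i + 1, c, d)\<close> satisfy \<open>b \<noteq> c\<close>, so one
  of them lies in the junction given by \<open>i\<close> and \<open>y\<close>. Rotations and flips of the bits shared by two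
  consecutive layers act transitively.

  Adjacent vertices of a layer that share a bit are the common edge of two triangles whose other
  corners are not adjacent, and no edge between two layers has this property; so automorphisms
  preserve the layers.

  Let \<open>Q n\<close> be a Cayley graph of \<open>G\<close> with \<open>n\<close> prime. The layer of \<open>\<one>\<close> is a subgroup \<open>H\<close> of order
  \<open>4\<close> whose left cosets are the layers. Since \<open>4 n < n\<^sup>2\<close>, the Sylow subgroup \<open>P\<close> of order \<open>n\<close> is
  normal; it meets every layer once. If \<open>r \<in> P\<close> lies in the layer after \<open>H\<close>, then \<open>r\<^sup>-\<^sup>1\<close> lies in
  the layer before \<open>H\<close>, and \<open>h\<^sup>-\<^sup>1 r h \<in> {r, r\<^sup>-\<^sup>1}\<close> for \<open>h \<in> H\<close>. So \<open>h\<close> is adjacent to \<open>r h\<close> if and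
  only if \<open>\<one>\<close> is adjacent to \<open>r\<close>. Take the \<open>h \<in> H\<close> that differs from \<open>\<one>\<close> only in the first bit.
  Then \<open>r\<close> and \<open>r h\<close> have the same first bit, hence a common neighbour in \<open>H\<close>; translating by
  \<open>r\<^sup>-\<^sup>1\<close>, \<open>\<one>\<close> and \<open>h\<close> have a common neighbour in the layer before \<open>H\<close>, so their first bits agree.
\<close>

section \<open>Cliques, stable sets and connectedness\<close>

lemma Max_card_eqI:
  assumes "finite V" "\<And>A. P A \<Longrightarrow> A \<subseteq> V" "\<And>A. P A \<Longrightarrow> card A \<le> k" "P B" "card B = k"
  shows "Max (card ` {A. P A}) = k"
proof (rule Max_eqI)
  have "{A. P A} \<subseteq> Pow V"
    using assms(2) by blast
  then show "finite (card ` {A. P A})"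
    using assms(1) finite_subset by blast
qed (use assms in auto)

lemma clique_number_eqI:
  assumes "finite (pverts \<Gamma>)"
    and "\<And>K. is_clique \<Gamma> K \<Longrightarrow> card K \<le> k"
    and "is_clique \<Gamma> C" "card C = k"
  shows "clique_number \<Gamma> = k"
  unfolding clique_number_def
  using assms by (intro Max_card_eqI[of "pverts \<Gamma>"]) (auto simp: is_clique_def)

lemma stability_number_eqI:
  assumes "finite (pverts \<Gamma>)"
    and "\<And>S. is_stable_set \<Gamma> S \<Longrightarrow> card S \<le> k"
    and "is_stable_set \<Gamma> T" "card T = k"
  shows "stability_number \<Gamma> = k"
  unfolding stability_number_def
  using assms by (intro Max_card_eqI[of "pverts \<Gamma>"]) (auto simp: is_stable_set_def)

lemma clique_inter_stable_set_unique:
  assumes "is_clique \<Gamma> K" "is_stable_set \<Gamma> S" "u \<in> K \<inter> S" "v \<in> K \<inter> S"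
  shows "u = v"
  using assms unfolding is_clique_def is_stable_set_def by blast

lemma (in pair_graph) maximal_stable_set_dominating:
  assumes S: "is_maximal_stable_set G S" and v: "v \<in> pverts G" "v \<notin> S"
  shows "\<exists>w\<in>S. (v, w) \<in> parcs G"
proof (rule ccontr)
  assume none: "\<not> ?thesis"
  have "(v, v) \<notin> parcs G"
    using pair_no_loops by force
  moreover have "(w, v) \<notin> parcs G" if "w \<in> S" for w
    using none that graph_symmetric by blast
  ultimately have "is_stable_set G (insert v S)"
    using S v none unfolding is_maximal_stable_set_def is_stable_set_def by auto
  then show False
    using S v unfolding is_maximal_stable_set_def by blast
qed

lemma (in pair_sym_digraph) connectedI_reachable_root:
  assumes root: "r \<in> pverts G" and reach: "\<And>v. v \<in> pverts G \<Longrightarrow> v \<rightarrow>\<^sup>*\<^bsub>with_proj G\<^esub> r"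
  shows "Digraph_Component.connected (with_proj G)"
proof (rule connectedI)
  show "pverts G \<noteq> {}"
    using root by auto
next
  fix u v assume "u \<in> pverts G" "v \<in> pverts G"
  then have "u \<rightarrow>\<^sup>*\<^bsub>with_proj G\<^esub> r" "r \<rightarrow>\<^sup>*\<^bsub>with_proj G\<^esub> v"
    using reach symmetric_reachable' by auto
  then have "u \<rightarrow>\<^sup>*\<^bsub>with_proj G\<^esub> v"
    by (rule reachable_trans)
  then show "u \<rightarrow>\<^sup>*\<^bsub>with_proj (mk_symmetric (with_proj G))\<^esub> v"
    by (rule reachable_mk_symmetricI)
qed

section \<open>Graph isomorphisms\<close>

definition is_graph_iso :: "'a pair_pre_digraph \<Rightarrow> 'b pair_pre_digraph \<Rightarrow> ('a \<Rightarrow> 'b) \<Rightarrow> bool" where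
  "is_graph_iso \<Gamma> \<Delta> f \<longleftrightarrow> bij_betw f (pverts \<Gamma>) (pverts \<Delta>) \<and>
     (\<forall>u\<in>pverts \<Gamma>. \<forall>v\<in>pverts \<Gamma>. (f u, f v) \<in> parcs \<Delta> \<longleftrightarrow> (u, v) \<in> parcs \<Gamma>)"

lemma is_graph_isoI_inverse:
  assumes "\<And>v. v \<in> pverts \<Gamma> \<Longrightarrow> f v \<in> pverts \<Delta> \<and> g (f v) = v"
    and "\<And>w. w \<in> pverts \<Delta> \<Longrightarrow> g w \<in> pverts \<Gamma> \<and> f (g w) = w"
    and "\<And>u v. (u, v) \<in> parcs \<Gamma> \<Longrightarrow> (f u, f v) \<in> parcs \<Delta>"
    and "\<And>u v. (u, v) \<in> parcs \<Delta> \<Longrightarrow> (g u, g v) \<in> parcs \<Gamma>"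
  shows "is_graph_iso \<Gamma> \<Delta> f"
  unfolding is_graph_iso_def
proof (intro conjI ballI)
  show "bij_betw f (pverts \<Gamma>) (pverts \<Delta>)"
    using assms(1,2) by (intro bij_betw_byWitness[where f' = g]) auto
  show "(f u, f v) \<in> parcs \<Delta> \<longleftrightarrow> (u, v) \<in> parcs \<Gamma>" if "u \<in> pverts \<Gamma>" "v \<in> pverts \<Gamma>" for u v
    using that assms(1)[of u] assms(1)[of v] assms(3)[of u v] assms(4)[of "f u" "f v"] by auto
qed

lemma is_graph_iso_comp:
  assumes "is_graph_iso \<Gamma> \<Delta> f" "is_graph_iso \<Delta> \<Theta> g"
  shows "is_graph_iso \<Gamma> \<Theta> (g \<circ> f)"
  using assms unfolding is_graph_iso_def
  by (auto intro: bij_betw_trans dest: bij_betwE)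

lemma is_graph_iso_inv_into:
  assumes "is_graph_iso \<Gamma> \<Delta> f"
  shows "is_graph_iso \<Delta> \<Gamma> (inv_into (pverts \<Gamma>) f)"
proof -
  have bij: "bij_betw f (pverts \<Gamma>) (pverts \<Delta>)"
    using assms by (simp add: is_graph_iso_def)
  note inv = bij_betw_inv_into[OF bij] bij_betw_inv_into_right[OF bij]
  have "inv_into (pverts \<Gamma>) f w \<in> pverts \<Gamma>" if "w \<in> pverts \<Delta>" for w
    using inv(1) that by (rule bij_betw_apply)
  then show ?thesis
    using assms inv unfolding is_graph_iso_def by metis
qed

lemma digraph_iso_with_proj_imp_is_graph_iso:
  assumes "digraph_iso (with_proj \<Gamma>) (with_proj \<Delta>)"
  shows "\<exists>f. is_graph_iso \<Gamma> \<Delta> f"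
proof -
  obtain F where F: "pre_digraph.digraph_isomorphism (with_proj \<Gamma>) F"
      and eq: "with_proj \<Delta> = app_iso F (with_proj \<Gamma>)"
    using assms unfolding digraph_iso_def by blast
  define f where "f = iso_verts F"
  interpret wf_digraph "with_proj \<Gamma>"
    using F by (simp add: pre_digraph.digraph_isomorphism_def)
  have inj: "inj_on f (pverts \<Gamma>)"
    using digraph_isomorphism_inj_on_verts[OF F] by (simp add: f_def)
  have verts: "f ` pverts \<Gamma> = pverts \<Delta>"
    using arg_cong[OF eq, of verts] by (simp add: f_def)
  have arcs: "parcs \<Delta> = (\<lambda>(u, v). (f u, f v)) ` parcs \<Gamma>"
    using arg_cong[OF eq, of arcs_ends] arcs_ends_app_iso_eq[OF F] by (simp add: f_def)
  have "(f u, f v) \<in> parcs \<Delta> \<longleftrightarrow> (u, v) \<in> parcs \<Gamma>" if uv: "u \<in> pverts \<Gamma>" "v \<in> pverts \<Gamma>" for u v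
  proof
    assume "(f u, f v) \<in> parcs \<Delta>"
    then obtain u' v' where arc: "(u', v') \<in> parcs \<Gamma>" and "f u = f u'" "f v = f v'"
      unfolding arcs by auto
    moreover have "u' \<in> pverts \<Gamma>" "v' \<in> pverts \<Gamma>"
      using arc tail_in_verts[of "(u', v')"] head_in_verts[of "(u', v')"] by simp_all
    ultimately have "u = u'" "v = v'"
      using inj uv by (auto dest: inj_onD)
    with arc show "(u, v) \<in> parcs \<Gamma>" by simp
  qed (auto simp: arcs)
  with inj verts show ?thesis
    by (auto simp: is_graph_iso_def bij_betw_def)
qed

lemma (in pair_wf_digraph) is_vertex_transitiveI:
  assumes ex: "\<And>u v. u \<in> pverts G \<Longrightarrow> v \<in> pverts G \<Longrightarrow> \<exists>f. is_graph_iso G G f \<and> f u = v"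
  shows "is_vertex_transitive G"
  unfolding is_vertex_transitive_def
proof (intro ballI)
  fix u v assume "u \<in> pverts G" "v \<in> pverts G"
  then obtain f where f: "is_graph_iso G G f" "f u = v"
    using ex by blast
  define F where "F = \<lparr>iso_verts = f, iso_arcs = map_prod f f, iso_head = snd, iso_tail = fst\<rparr>"
  have inj: "inj_on f (pverts G)" and surj: "f ` pverts G = pverts G"
    using f(1) by (auto simp: is_graph_iso_def bij_betw_def)
  have ends: "parcs G \<subseteq> pverts G \<times> pverts G"
    using in_arcsD1 in_arcsD2 by auto
  have "map_prod f f ` (pverts G \<times> pverts G) = pverts G \<times> pverts G"
    using surj surj by (rule map_prod_surj_on)
  then have "parcs G = {a \<in> map_prod f f ` (pverts G \<times> pverts G). a \<in> parcs G}"
    using ends by auto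
  also have "\<dots> = map_prod f f ` {a \<in> pverts G \<times> pverts G. map_prod f f a \<in> parcs G}"
    by (rule Compr_image_eq)
  also have "{a \<in> pverts G \<times> pverts G. map_prod f f a \<in> parcs G} = parcs G"
    using f(1) ends by (auto simp: is_graph_iso_def)
  finally have arcs_image: "map_prod f f ` parcs G = parcs G"
    by (rule sym)
  have "inj_on (map_prod f f) (parcs G)"
    using map_prod_inj_on[OF inj inj] ends by (rule inj_on_subset)
  with inj have "pre_digraph.digraph_isomorphism (with_proj G) F"
    using wf_digraph by (simp add: pre_digraph.digraph_isomorphism_def F_def)
  moreover have "app_iso F (with_proj G) = with_proj G"
    using surj arcs_image by (simp add: app_iso_def with_proj_def F_def)
  ultimately show "\<exists>F. pre_digraph.digraph_isomorphism (with_proj G) F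
      \<and> app_iso F (with_proj G) = with_proj G \<and> iso_verts F u = v"
    using f(2) by (intro exI[of _ F]) (simp add: F_def)
qed

definition in_diamond :: "'a pair_pre_digraph \<Rightarrow> 'a \<Rightarrow> 'a \<Rightarrow> bool" where
  "in_diamond \<Gamma> u v \<longleftrightarrow> (u, v) \<in> parcs \<Gamma> \<and>
     (\<exists>s\<in>pverts \<Gamma>. \<exists>t\<in>pverts \<Gamma>. s \<noteq> t \<and> (s, t) \<notin> parcs \<Gamma> \<and>
        {(u, s), (v, s), (u, t), (v, t)} \<subseteq> parcs \<Gamma>)"

lemma is_graph_iso_in_diamond:
  assumes f: "is_graph_iso \<Gamma> \<Delta> f" and uv: "u \<in> pverts \<Gamma>" "v \<in> pverts \<Gamma>" "in_diamond \<Gamma> u v"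
  shows "in_diamond \<Delta> (f u) (f v)"
proof -
  obtain s t where st: "s \<in> pverts \<Gamma>" "t \<in> pverts \<Gamma>" "s \<noteq> t" "(s, t) \<notin> parcs \<Gamma>"
      and arcs: "{(u, v), (u, s), (v, s), (u, t), (v, t)} \<subseteq> parcs \<Gamma>"
    using uv(3) unfolding in_diamond_def by blast
  have bij: "bij_betw f (pverts \<Gamma>) (pverts \<Delta>)"
    using f by (simp add: is_graph_iso_def)
  have "f s \<noteq> f t"
    using bij st by (auto simp: bij_betw_def dest: inj_onD)
  moreover have "f s \<in> pverts \<Delta>" "f t \<in> pverts \<Delta>"
    using bij st by (auto dest: bij_betwE)
  moreover have "(f s, f t) \<notin> parcs \<Delta>"
      "{(f u, f v), (f u, f s), (f v, f s), (f u, f t), (f v, f t)} \<subseteq> parcs \<Delta>"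
    using f uv(1,2) st arcs by (simp_all add: is_graph_iso_def)
  ultimately show ?thesis
    unfolding in_diamond_def by auto
qed

section \<open>Subgroups of finite groups\<close>

lemma (in group) card_subgroup_dvd:
  assumes H: "subgroup H G" and K: "subgroup K G" and "H \<subseteq> K"
  shows "card H dvd card K"
proof -
  interpret K: group "G\<lparr>carrier := K\<rparr>"
    using K is_group by (rule subgroup.subgroup_is_group)
  have "card (rcosets\<^bsub>G\<lparr>carrier := K\<rparr>\<^esub> H) * card H = card K"
    using K.lagrange[of H] subgroup_incl[OF assms] by (simp add: order_def)
  then show ?thesis
    by (metis dvd_triv_right)
qed

lemma (in group) subgroup_card_1_eq:
  assumes "subgroup H G" "card H = 1"
  shows "H = {\<one>}"
  using assms by (metis card_1_singletonE singletonD subgroup.one_closed)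

lemma (in group) coprime_subgroups_inter:
  assumes H: "subgroup H G" and K: "subgroup K G" and "coprime (card H) (card K)"
  shows "H \<inter> K = {\<one>}"
proof -
  have sub: "subgroup (H \<inter> K) G"
    using H K by (rule subgroups_Inter_pair)
  then have "card (H \<inter> K) dvd card H" "card (H \<inter> K) dvd card K"
    using H K by (auto intro: card_subgroup_dvd)
  then have "card (H \<inter> K) = 1"
    using assms(3) coprime_common_divisor_nat by blast
  with sub show ?thesis
    by (rule subgroup_card_1_eq)
qed

lemma (in group) odd_subgroup_no_involution:
  assumes P: "subgroup P G" "odd (card P)" and x: "x \<in> P" "x \<otimes> x = \<one>"
  shows "x = \<one>"
proof (rule ccontr)
  assume "x \<noteq> \<one>"
  have G: "x \<in> carrier G"
    using P(1) x(1) by (rule subgroup.mem_carrier)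
  then have "inv x = x"
    using x(2) by (simp add: inv_equality)
  then have "subgroup {\<one>, x} G"
    using G x(2) by (intro subgroupI) auto
  moreover have "{\<one>, x} \<subseteq> P"
    using x(1) subgroup.one_closed[OF P(1)] by simp
  ultimately have "card {\<one>, x} dvd card P"
    using P(1) by (intro card_subgroup_dvd)
  moreover have "card {\<one>, x} = 2"
    using \<open>x \<noteq> \<one>\<close> by simp
  ultimately show False
    using P(2) by simp
qed

lemma (in group) card_disjoint_subgroups_le_order:
  assumes H: "subgroup H G" and K: "subgroup K G" and "H \<inter> K = {\<one>}" and fin: "finite (carrier G)"
  shows "card H * card K \<le> order G"
proof -
  interpret HK: group_disjoint_sum G H K
    using H K by (simp add: group_disjoint_sum_def is_group)
  have "inj_on (\<lambda>(a, b). a \<otimes> b) (H \<times> K)"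
    using HK.cancel assms(3) by (auto simp: inj_on_def)
  moreover have "(\<lambda>(a, b). a \<otimes> b) ` (H \<times> K) \<subseteq> carrier G"
    by auto
  ultimately have "card (H \<times> K) \<le> card (carrier G)"
    using fin by (rule card_inj_on_le)
  then show ?thesis
    by (simp add: card_cartesian_product order_def)
qed

lemma (in group) prime_order_subgroups_eq:
  assumes H: "subgroup H G" "card H = p" and K: "subgroup K G" "card K = p"
    and p: "prime p" and fin: "finite (carrier G)" and small: "order G < p * p"
  shows "H = K"
proof -
  have sub: "subgroup (H \<inter> K) G"
    using H(1) K(1) by (rule subgroups_Inter_pair)
  have "card (H \<inter> K) \<noteq> 1"
  proof
    assume "card (H \<inter> K) = 1"
    with sub have "H \<inter> K = {\<one>}"
      by (rule subgroup_card_1_eq)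
    then show False
      using card_disjoint_subgroups_le_order[OF H(1) K(1) _ fin] H(2) K(2) small by simp
  qed
  moreover have "card (H \<inter> K) dvd p"
    using card_subgroup_dvd[OF sub H(1)] H(2) by simp
  ultimately have card: "card (H \<inter> K) = p"
    using p by (auto simp: prime_nat_iff)
  have "finite H" "finite K"
    using subgroup.subset[OF H(1)] subgroup.subset[OF K(1)] fin by (auto intro: finite_subset)
  then have "H \<inter> K = H" "H \<inter> K = K"
    using card H(2) K(2) by (simp_all add: card_subset_eq)
  then show ?thesis by simp
qed

lemma (in group) prime_order_subgroup_normal:
  assumes P: "subgroup P G" and p: "prime (card P)" and fin: "finite (carrier G)"
    and small: "order G < card P * card P"
  shows "P \<lhd> G"
proof (rule normal_invI[OF P])
  fix g x assume g: "g \<in> carrier G" and x: "x \<in> P"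
  define conj where "conj = (\<lambda>x. g \<otimes> x \<otimes> inv g)"
  have "g <# P #> inv g = conj ` P"
    by (auto simp: l_coset_def r_coset_def conj_def)
  then have "subgroup (conj ` P) G"
    using subgroup_conjugation_is_surj2[OF g P] by simp
  moreover have "inj_on conj P"
    using conjugation_is_inj[OF g] subgroup.mem_carrier[OF P] by (auto simp: inj_on_def conj_def)
  then have "card (conj ` P) = card P"
    by (rule card_image)
  ultimately have "conj ` P = P"
    using prime_order_subgroups_eq P p fin small by blast
  then show "g \<otimes> x \<otimes> inv g \<in> P"
    using x by (auto simp: conj_def)
qed

section \<open>Adjacency in Q\<close>

definition cyc_succ :: "nat \<Rightarrow> nat \<Rightarrow> nat" where
  "cyc_succ n i = (i + 1) mod n"

lemma cyc_succ_less: "i < n \<Longrightarrow> cyc_succ n i < n"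
  by (simp add: cyc_succ_def)

lemma cyc_succ_eq_iff:
  assumes "i < n" "j < n"
  shows "cyc_succ n i = cyc_succ n j \<longleftrightarrow> i = j"
  using assms by (auto simp: cyc_succ_def mod_Suc)

lemma cyc_pred_unique:
  assumes "i < n"
  obtains j where "j < n" "\<And>k. k < n \<Longrightarrow> i = cyc_succ n k \<longleftrightarrow> k = j"
proof -
  define j where "j = (if i = 0 then n - 1 else i - 1)"
  have "j < n" "i = cyc_succ n j"
    using assms by (auto simp: j_def cyc_succ_def)
  then show thesis
    using that cyc_succ_eq_iff by metis
qed

lemma cyc_succ_neq:
  assumes "i < n"
  shows "n \<ge> 2 \<Longrightarrow> cyc_succ n i \<noteq> i"
    and "n \<ge> 3 \<Longrightarrow> cyc_succ n (cyc_succ n i) \<noteq> i"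
    and "n \<ge> 4 \<Longrightarrow> cyc_succ n (cyc_succ n (cyc_succ n i)) \<noteq> i"
  using assms by (auto simp: cyc_succ_def mod_Suc)

definition cyc_adjacent :: "nat \<Rightarrow> nat \<Rightarrow> nat \<Rightarrow> bool" where
  "cyc_adjacent n i j \<longleftrightarrow> j = cyc_succ n i \<or> i = cyc_succ n j"

lemma Q_verts_iff: "(i, x, y) \<in> pverts (Q n) \<longleftrightarrow> i < n \<and> x < 2 \<and> y < 2"
  by (simp add: Q_def)

lemma finite_Q_verts: "finite (pverts (Q n))"
  by (simp add: Q_def)

lemma card_Q_verts: "card (pverts (Q n)) = 4 * n"
  by (simp add: Q_def)

lemma Q_arc_sym: "(u, v) \<in> parcs (Q n) \<longleftrightarrow> (v, u) \<in> parcs (Q n)"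
  by (simp add: Q_def insert_commute)

lemma Q_arc_iff:
  "((i, x, y), (j, u, v)) \<in> parcs (Q n) \<longleftrightarrow>
    (i < n \<and> x < 2 \<and> y < 2) \<and> (j < n \<and> u < 2 \<and> v < 2) \<and>
    (i = j \<and> (x, y) \<noteq> (u, v) \<or> j = cyc_succ n i \<and> u = y \<or> i = cyc_succ n j \<and> x = v)"
    (is "?L \<longleftrightarrow> ?R")
proof
  assume ?L
  then consider
      (between) k a b c where "k < n" "a < 2" "b < 2" "c < 2"
        "{(i, x, y), (j, u, v)} = {(k, a, b), (cyc_succ n k, b, c)}"
    | (within) k a b c d where "k < n" "a < 2" "b < 2" "c < 2" "d < 2" "(a, b) \<noteq> (c, d)"
        "{(i, x, y), (j, u, v)} = {(k, a, b), (k, c, d)}"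
    unfolding Q_def Q_edges_def cyc_succ_def by auto
  then show ?R
  proof cases
    case between
    then show ?thesis
      using cyc_succ_less[of k n] by (auto simp: doubleton_eq_iff)
  next
    case within
    then show ?thesis
      by (auto simp: doubleton_eq_iff)
  qed
next
  assume R: ?R
  have between: "{(k, a, b), (cyc_succ n k, b, c)} \<in> Q_edges n"
    if "k < n" "a < 2" "b < 2" "c < 2" for k a b c
    unfolding Q_edges_def cyc_succ_def using that by blast
  have within: "{(k, a, b), (k, c, d)} \<in> Q_edges n"
    if "k < n" "a < 2" "b < 2" "c < 2" "d < 2" "(a, b) \<noteq> (c, d)" for k a b c d
    unfolding Q_edges_def using that by blast
  have "{(i, x, y), (j, u, v)} \<in> Q_edges n"
    using R between[of i x y v] between[of j u v y] within[of i x y u v]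
    by (auto simp: insert_commute)
  then show ?L
    by (simp add: Q_def)
qed

lemma Q_arc_verts:
  assumes "(u, v) \<in> parcs (Q n)"
  shows "u \<in> pverts (Q n)" "v \<in> pverts (Q n)"
  using assms by (cases u; cases v; simp add: Q_arc_iff Q_verts_iff)+

lemma Q_arc_layers:
  assumes "(u, v) \<in> parcs (Q n)"
  shows "fst u = fst v \<or> cyc_adjacent n (fst u) (fst v)"
  using assms by (cases u; cases v) (auto simp: Q_arc_iff cyc_adjacent_def)

lemma Q_consecutive_arcE:
  assumes "n \<ge> 3" "(u, v) \<in> parcs (Q n)" "fst v = cyc_succ n (fst u)"
  obtains i x y z where "u = (i, x, y)" "v = (cyc_succ n i, y, z)" "i < n" "x < 2" "y < 2" "z < 2"
proof -
  obtain i x y where u: "u = (i, x, y)" "i < n" "x < 2" "y < 2"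
    using Q_arc_verts(1)[OF assms(2)] by (cases u) (auto simp: Q_verts_iff)
  have "cyc_succ n i \<noteq> i" "cyc_succ n (cyc_succ n i) \<noteq> i"
    using assms(1) cyc_succ_neq[OF u(2)] by simp_all
  then obtain z where "v = (cyc_succ n i, y, z)" "z < 2"
    using assms(2,3) u by (cases v) (auto simp: Q_arc_iff)
  with u that show thesis by blast
qed

lemma Q_reachable_origin:
  assumes "n \<ge> 3" "(i, x, y) \<in> pverts (Q n)"
  shows "(i, x, y) \<rightarrow>\<^sup>*\<^bsub>with_proj (Q n)\<^esub> (0, 0, 0)"
proof -
  interpret pair_graph "Q n"
    using assms(1) by (rule Q_pair_graph)
  show ?thesis
    using assms(2)
  proof (induction i arbitrary: x y)
    case 0
    show ?case
    proof (cases "(x, y) = (0, 0)")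
      case False
      then show ?thesis
        using 0 by (intro reachable_adjI) (auto simp: Q_arc_iff Q_verts_iff)
    qed (use 0 in simp)
  next
    case (Suc i)
    then have "i < n" "cyc_succ n i = Suc i" "x < 2"
      by (simp_all add: Q_verts_iff cyc_succ_def)
    then have "(Suc i, x, y) \<rightarrow>\<^sup>*\<^bsub>with_proj (Q n)\<^esub> (i, 0, x)"
      using Suc.prems by (intro reachable_adjI) (simp add: Q_arc_iff Q_verts_iff)
    also have "\<dots> \<rightarrow>\<^sup>*\<^bsub>with_proj (Q n)\<^esub> (0, 0, 0)"
      using \<open>i < n\<close> \<open>x < 2\<close> by (intro Suc.IH) (simp add: Q_verts_iff)
    finally show ?case .
  qed
qed

lemma Q_connected:
  assumes "n \<ge> 3"
  shows "Digraph_Component.connected (with_proj (Q n))"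
proof -
  interpret pair_graph "Q n"
    using assms by (rule Q_pair_graph)
  show ?thesis
  proof (rule connectedI_reachable_root)
    show "(0, 0, 0) \<in> pverts (Q n)"
      using assms by (simp add: Q_verts_iff)
    show "v \<rightarrow>\<^sup>*\<^bsub>with_proj (Q n)\<^esub> (0, 0, 0)" if "v \<in> pverts (Q n)" for v
      using assms Q_reachable_origin that by (cases v) simp
  qed
qed

section \<open>Layers and junctions\<close>

definition Q_layer :: "nat \<Rightarrow> (nat \<times> nat \<times> nat) set" where
  "Q_layer i = {i} \<times> {..<2} \<times> {..<2}"

definition Q_junction :: "nat \<Rightarrow> nat \<Rightarrow> nat \<Rightarrow> (nat \<times> nat \<times> nat) set" where
  "Q_junction n i y = {i} \<times> {..<2} \<times> {y} \<union> {cyc_succ n i} \<times> {y} \<times> {..<2}"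

lemma mem_Q_layer_iff: "v \<in> pverts (Q n) \<Longrightarrow> v \<in> Q_layer i \<longleftrightarrow> fst v = i"
  by (cases v) (auto simp: Q_layer_def Q_verts_iff)

lemma card_Q_layer: "card (Q_layer i) = 4"
  by (simp add: Q_layer_def)

lemma card_Q_junction_le: "card (Q_junction n i y) \<le> 4"
proof -
  have "card (Q_junction n i y)
      \<le> card ({i} \<times> {..<2::nat} \<times> {y}) + card ({cyc_succ n i} \<times> {y} \<times> {..<2::nat})"
    unfolding Q_junction_def by (rule card_Un_le)
  then show ?thesis by simp
qed

lemma Q_layer_is_clique:
  assumes "i < n"
  shows "is_clique (Q n) (Q_layer i)"
  using assms by (auto simp: is_clique_def Q_layer_def Q_arc_iff Q_verts_iff)

lemma Q_junction_is_clique: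
  assumes "i < n" "y < 2"
  shows "is_clique (Q n) (Q_junction n i y)"
  using assms cyc_succ_less[OF assms(1)]
  by (auto simp: is_clique_def Q_junction_def Q_arc_iff Q_verts_iff)

lemma Q_has_valency:
  assumes "n \<ge> 3"
  shows "has_valency (Q n) 7"
  unfolding has_valency_def
proof
  fix v assume v: "v \<in> pverts (Q n)"
  then obtain i x y where v_eq: "v = (i, x, y)" and i: "i < n" and xy: "x < 2" "y < 2"
    by (cases v) (auto simp: Q_verts_iff)
  obtain j where j: "j < n" and prev_iff: "\<And>k. k < n \<Longrightarrow> i = cyc_succ n k \<longleftrightarrow> k = j"
    using i by (rule cyc_pred_unique) blast
  define nexts where "nexts = {cyc_succ n i} \<times> {y} \<times> {..<2::nat}"
  define prevs where "prevs = {j} \<times> {..<2::nat} \<times> {x}"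
  have "{w \<in> pverts (Q n). (v, w) \<in> parcs (Q n)} = Q_layer i - {v} \<union> nexts \<union> prevs"
    using i j xy cyc_succ_less[OF i] unfolding v_eq
    by (auto simp: Q_arc_iff Q_verts_iff Q_layer_def nexts_def prevs_def prev_iff)
  also have "card \<dots> = card (Q_layer i - {v}) + card nexts + card prevs"
  proof -
    have "cyc_succ n i \<noteq> i" "cyc_succ n i \<noteq> j" "j \<noteq> i"
      using assms prev_iff[OF j] cyc_succ_neq(1)[OF i] cyc_succ_neq(1,2)[OF j] by auto
    then have "(Q_layer i - {v}) \<inter> nexts = {}" "(Q_layer i - {v} \<union> nexts) \<inter> prevs = {}"
      by (auto simp: Q_layer_def nexts_def prevs_def)
    moreover have "finite (Q_layer i)" "finite nexts" "finite prevs"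
      by (simp_all add: Q_layer_def nexts_def prevs_def)
    ultimately show ?thesis
      by (simp add: card_Un_disjoint)
  qed
  also have "\<dots> = 7"
    using v by (simp add: card_Q_layer mem_Q_layer_iff v_eq nexts_def prevs_def)
  finally show "card {w \<in> pverts (Q n). (v, w) \<in> parcs (Q n)} = 7" .
qed

section \<open>Cliques and stable sets of Q\<close>

lemma Q_common_neighbour_mem_junction:
  assumes n_ge_4: "n \<ge> 4"
    and w: "((i, x, y), w) \<in> parcs (Q n)" "((cyc_succ n i, y, z), w) \<in> parcs (Q n)"
  shows "w \<in> Q_junction n i y"
proof -
  obtain k a b where w_eq: "w = (k, a, b)"
    by (cases w)
  have bounds: "i < n" "k < n" "a < 2" "b < 2"
    using w(1) by (simp_all add: w_eq Q_arc_iff)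
  have "k = i \<or> k = cyc_succ n i \<and> a = y \<or> i = cyc_succ n k"
    using w(1) by (auto simp: w_eq Q_arc_iff)
  moreover have "k = cyc_succ n i \<or> k = cyc_succ n (cyc_succ n i) \<or> k = i \<and> b = y"
    using w(2) cyc_succ_eq_iff[OF bounds(1,2)] by (auto simp: w_eq Q_arc_iff)
  moreover have "cyc_succ n i \<noteq> i" "cyc_succ n (cyc_succ n i) \<noteq> i"
      "cyc_succ n (cyc_succ n (cyc_succ n i)) \<noteq> i"
    using n_ge_4 cyc_succ_neq[OF bounds(1)] by simp_all
  ultimately have "k = i \<and> b = y \<or> k = cyc_succ n i \<and> a = y"
    by metis
  then show ?thesis
    using bounds by (auto simp: w_eq Q_junction_def)
qed

lemma Q_consecutive_clique_subset_junction:
  assumes n_ge_4: "n \<ge> 4" and K: "is_clique (Q n) K"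
    and uv: "u \<in> K" "v \<in> K" "fst v = cyc_succ n (fst u)"
  shows "\<exists>i<n. \<exists>y<2. K \<subseteq> Q_junction n i y"
proof -
  have adj: "(s, t) \<in> parcs (Q n)" if "s \<in> K" "t \<in> K" "s \<noteq> t" for s t
    using K that by (simp add: is_clique_def)
  have "fst u < n"
    using K uv(1) by (cases u) (auto simp: is_clique_def Q_verts_iff)
  then have "cyc_succ n (fst u) \<noteq> fst u"
    using n_ge_4 cyc_succ_neq(1) by simp
  then have arc: "(u, v) \<in> parcs (Q n)"
    using adj uv by metis
  then obtain i x y z where u: "u = (i, x, y)" and v: "v = (cyc_succ n i, y, z)"
      and bounds: "i < n" "x < 2" "y < 2" "z < 2"
    using n_ge_4 uv(3) by (elim Q_consecutive_arcE[rotated]) simp_all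
  have "w \<in> Q_junction n i y" if w: "w \<in> K" for w
  proof (cases "w = u \<or> w = v")
    case True
    then show ?thesis
      using u v bounds by (auto simp: Q_junction_def)
  next
    case False
    then show ?thesis
      using adj uv w Q_common_neighbour_mem_junction[OF n_ge_4] u v by metis
  qed
  with bounds show ?thesis by blast
qed

lemma Q_clique_subset_layer_or_junction:
  assumes n_ge_4: "n \<ge> 4" and K: "is_clique (Q n) K"
  obtains (layer) i where "i < n" "K \<subseteq> Q_layer i"
    | (junction) i y where "i < n" "y < 2" "K \<subseteq> Q_junction n i y"
proof -
  consider (consecutive) u v where "u \<in> K" "v \<in> K" "fst v = cyc_succ n (fst u)"
    | (empty) "K = {}"
    | (separate) u where "u \<in> K" "\<And>v w. v \<in> K \<Longrightarrow> w \<in> K \<Longrightarrow> fst w \<noteq> cyc_succ n (fst v)"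
    by blast
  then show thesis
  proof cases
    case consecutive
    then show thesis
      using Q_consecutive_clique_subset_junction[OF n_ge_4 K] junction by blast
  next
    case empty
    then show thesis
      using n_ge_4 by (intro layer[of 0]) auto
  next
    case (separate u)
    have verts: "K \<subseteq> pverts (Q n)"
      using K by (simp add: is_clique_def)
    have "fst v = fst u" if "v \<in> K" for v
    proof -
      have "u = v \<or> (u, v) \<in> parcs (Q n)"
        using K separate(1) that by (auto simp: is_clique_def)
      moreover have "\<not> cyc_adjacent n (fst u) (fst v)"
        using separate that by (simp add: cyc_adjacent_def)
      ultimately show ?thesis
        using Q_arc_layers by metis
    qed
    then have "K \<subseteq> Q_layer (fst u)"
      using verts mem_Q_layer_iff by blast
    moreover have "fst u < n"
      using separate(1) verts by (cases u) (auto simp: Q_verts_iff)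
    ultimately show thesis
      by (intro layer)
  qed
qed

lemma Q_maximal_clique_cases:
  assumes n_ge_4: "n \<ge> 4" and K: "is_maximal_clique (Q n) K"
  obtains (layer) i where "i < n" "K = Q_layer i"
    | (junction) i y where "i < n" "y < 2" "K = Q_junction n i y"
proof -
  have clique: "is_clique (Q n) K"
    and max: "\<And>C. is_clique (Q n) C \<Longrightarrow> K \<subseteq> C \<Longrightarrow> K = C"
    using K unfolding is_maximal_clique_def by blast+
  from n_ge_4 clique show thesis
    by (cases rule: Q_clique_subset_layer_or_junction)
      (use max Q_layer_is_clique Q_junction_is_clique layer junction in metis)+
qed

lemma Q_clique_number:
  assumes n_ge_4: "n \<ge> 4"
  shows "clique_number (Q n) = 4"
proof (rule clique_number_eqI)
  fix K assume "is_clique (Q n) K"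
  with n_ge_4 show "card K \<le> 4"
  proof (cases rule: Q_clique_subset_layer_or_junction)
    case (layer i)
    then show ?thesis
      using card_mono[of "Q_layer i" K] card_Q_layer[of i] by (simp add: Q_layer_def)
  next
    case (junction i y)
    then have "card K \<le> card (Q_junction n i y)"
      by (intro card_mono) (simp_all add: Q_junction_def)
    then show ?thesis
      using card_Q_junction_le le_trans by blast
  qed
next
  show "is_clique (Q n) (Q_layer 0)"
    using n_ge_4 by (intro Q_layer_is_clique) simp
qed (simp_all add: finite_Q_verts card_Q_layer)

lemma Q_stable_set_inj_on_fst:
  assumes S: "is_stable_set (Q n) S"
  shows "inj_on fst S"
proof (rule inj_onI)
  fix u v assume uv: "u \<in> S" "v \<in> S" "fst u = fst v"
  then have verts: "u \<in> pverts (Q n)" "v \<in> pverts (Q n)"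
    using S by (auto simp: is_stable_set_def)
  then have "fst u < n"
    by (cases u) (simp add: Q_verts_iff)
  then have "is_clique (Q n) (Q_layer (fst u))"
    by (rule Q_layer_is_clique)
  then show "u = v"
    using S by (rule clique_inter_stable_set_unique)
      (use uv verts in \<open>simp_all add: mem_Q_layer_iff\<close>)
qed

lemma Q_stability_number: "stability_number (Q n) = n"
proof (rule stability_number_eqI)
  fix S assume S: "is_stable_set (Q n) S"
  then have "fst ` S \<subseteq> {..<n}"
    by (auto simp: is_stable_set_def Q_def)
  with Q_stable_set_inj_on_fst[OF S] have "card S \<le> card {..<n}"
    by (rule card_inj_on_le) simp
  then show "card S \<le> n" by simp
next
  show "is_stable_set (Q n) ({..<n} \<times> {0} \<times> {1})"
    by (auto simp: is_stable_set_def Q_arc_iff Q_verts_iff)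
qed (simp_all add: finite_Q_verts)

lemma Q_maximal_stable_set_meets_layer:
  assumes n_ge_3: "n \<ge> 3" and S: "is_maximal_stable_set (Q n) S" and i: "i < n"
  shows "S \<inter> Q_layer i \<noteq> {}"
proof
  assume disjoint: "S \<inter> Q_layer i = {}"
  interpret pair_graph "Q n"
    using n_ge_3 by (rule Q_pair_graph)
  have inj: "inj_on fst S"
    using S unfolding is_maximal_stable_set_def by (blast intro: Q_stable_set_inj_on_fst)
  have missed_bit: "\<exists>b<2. \<forall>w\<in>S. fst w = k \<longrightarrow> bit w \<noteq> b" for k and bit :: "nat \<times> nat \<times> nat \<Rightarrow> nat"
  proof (rule ccontr)
    assume "\<not> ?thesis"
    then have hit: "\<exists>w\<in>S. fst w = k \<and> bit w = b" if "b < 2" for b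
      using that by blast
    obtain w\<^sub>0 w\<^sub>1 where "w\<^sub>0 \<in> S" "fst w\<^sub>0 = k" "bit w\<^sub>0 = 0" "w\<^sub>1 \<in> S" "fst w\<^sub>1 = k" "bit w\<^sub>1 = 1"
      using hit[of 0] hit[of 1] by auto
    then show False
      using inj_onD[OF inj, of w\<^sub>0 w\<^sub>1] by auto
  qed
  obtain j where j: "j < n" and prev_iff: "\<And>k. k < n \<Longrightarrow> i = cyc_succ n k \<longleftrightarrow> k = j"
    using i by (rule cyc_pred_unique) blast
  obtain a where a: "a < 2" "\<And>w. w \<in> S \<Longrightarrow> fst w = j \<Longrightarrow> snd (snd w) \<noteq> a"
    using missed_bit[of j "\<lambda>w. snd (snd w)"] by blast
  obtain b where b: "b < 2" "\<And>w. w \<in> S \<Longrightarrow> fst w = cyc_succ n i \<Longrightarrow> fst (snd w) \<noteq> b"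
    using missed_bit[of "cyc_succ n i" "\<lambda>w. fst (snd w)"] by blast
  have v: "(i, a, b) \<in> Q_layer i" "(i, a, b) \<in> pverts (Q n)"
    using a(1) b(1) i by (simp_all add: Q_layer_def Q_verts_iff)
  then obtain w where w: "w \<in> S" "((i, a, b), w) \<in> parcs (Q n)"
    using maximal_stable_set_dominating[OF S] disjoint by blast
  then have "w \<notin> Q_layer i"
    using disjoint by blast
  with w(2) have "fst w = cyc_succ n i \<and> fst (snd w) = b \<or> fst w = j \<and> snd (snd w) = a"
    using prev_iff by (cases w) (auto simp: Q_arc_iff Q_layer_def)
  then show False
    using a(2) b(2) w(1) by blast
qed

lemma Q_maximal_stable_set_meets_junction:
  assumes n_ge_3: "n \<ge> 3" and S: "is_maximal_stable_set (Q n) S" and i: "i < n" and y: "y < 2"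
  shows "S \<inter> Q_junction n i y \<noteq> {}"
proof -
  obtain a b where ab: "(i, a, b) \<in> S" "a < 2" "b < 2"
    using Q_maximal_stable_set_meets_layer[OF n_ge_3 S i] by (auto simp: Q_layer_def)
  obtain c d where cd: "(cyc_succ n i, c, d) \<in> S" "c < 2" "d < 2"
    using Q_maximal_stable_set_meets_layer[OF n_ge_3 S cyc_succ_less[OF i]]
    by (auto simp: Q_layer_def)
  have "((i, a, b), (cyc_succ n i, c, d)) \<notin> parcs (Q n)"
    using S ab(1) cd(1) by (simp add: is_maximal_stable_set_def is_stable_set_def)
  then have "b \<noteq> c"
    using ab cd i cyc_succ_less[OF i] by (auto simp: Q_arc_iff)
  then have "b = y \<or> c = y"
    using ab(3) cd(2) y by linarith
  then show ?thesis
    using ab cd by (auto simp: Q_junction_def)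
qed

lemma Q_is_CIS:
  assumes n_ge_4: "n \<ge> 4"
  shows "is_CIS (Q n)"
  unfolding is_CIS_def
proof (intro allI impI, elim conjE)
  fix S K assume S: "is_maximal_stable_set (Q n) S" and K: "is_maximal_clique (Q n) K"
  have "n \<ge> 3"
    using n_ge_4 by simp
  from n_ge_4 K show "S \<inter> K \<noteq> {}"
    by (cases rule: Q_maximal_clique_cases)
      (use Q_maximal_stable_set_meets_layer[OF \<open>n \<ge> 3\<close> S]
        Q_maximal_stable_set_meets_junction[OF \<open>n \<ge> 3\<close> S] in auto)
qed

section \<open>Automorphisms of Q\<close>

definition Q_rotate :: "nat \<Rightarrow> nat \<Rightarrow> nat \<times> nat \<times> nat \<Rightarrow> nat \<times> nat \<times> nat" where
  "Q_rotate n c = (\<lambda>(i, x, y). ((i + c) mod n, x, y))"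

definition Q_flip :: "nat \<Rightarrow> (nat \<Rightarrow> nat) \<Rightarrow> nat \<times> nat \<times> nat \<Rightarrow> nat \<times> nat \<times> nat" where
  "Q_flip n f = (\<lambda>(i, x, y). (i, (x + f i) mod 2, (y + f (cyc_succ n i)) mod 2))"

lemma Q_rotate_verts: "v \<in> pverts (Q n) \<Longrightarrow> Q_rotate n c v \<in> pverts (Q n)"
  by (cases v) (auto simp: Q_rotate_def Q_verts_iff)

lemma Q_rotate_inverse:
  assumes "v \<in> pverts (Q n)" "n dvd c + d"
  shows "Q_rotate n d (Q_rotate n c v) = v"
  using assms by (cases v) (auto simp: Q_rotate_def Q_verts_iff mod_simps add.assoc)

lemma Q_rotate_arc:
  assumes arc: "(u, v) \<in> parcs (Q n)"
  shows "(Q_rotate n c u, Q_rotate n c v) \<in> parcs (Q n)"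
proof -
  have "((k + c) mod n + 1) mod n = ((k + 1) mod n + c) mod n" for k
    by (simp add: mod_simps)
  with arc show ?thesis
    by (cases u; cases v) (auto simp: Q_arc_iff Q_rotate_def cyc_succ_def)
qed

lemma Q_rotate_is_graph_iso: "is_graph_iso (Q n) (Q n) (Q_rotate n c)"
proof (rule is_graph_isoI_inverse[where g = "Q_rotate n (n * c - c)"])
  fix v assume v: "v \<in> pverts (Q n)"
  then have "n > 0"
    by (cases v) (simp add: Q_verts_iff)
  then have "n dvd c + (n * c - c)" "n dvd (n * c - c) + c"
    by simp_all
  with v show "Q_rotate n c v \<in> pverts (Q n) \<and> Q_rotate n (n * c - c) (Q_rotate n c v) = v"
    and "Q_rotate n (n * c - c) v \<in> pverts (Q n) \<and> Q_rotate n c (Q_rotate n (n * c - c) v) = v"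
    by (simp_all add: Q_rotate_verts Q_rotate_inverse)
qed (auto intro: Q_rotate_arc)

lemma add_mod_2_eq_iff:
  fixes x y m :: nat
  assumes "x < 2" "y < 2"
  shows "(x + m) mod 2 = (y + m) mod 2 \<longleftrightarrow> x = y"
  using assms by presburger

lemma Q_flip_verts: "v \<in> pverts (Q n) \<Longrightarrow> Q_flip n f v \<in> pverts (Q n)"
  by (cases v) (simp add: Q_flip_def Q_verts_iff)

lemma Q_flip_involution:
  assumes "v \<in> pverts (Q n)"
  shows "Q_flip n f (Q_flip n f v) = v"
proof -
  have "((x + m) mod 2 + m) mod 2 = x" if "x < 2" for x m :: nat
    using that by presburger
  with assms show ?thesis
    by (cases v) (simp add: Q_flip_def Q_verts_iff)
qed

lemma Q_flip_arc: "(u, v) \<in> parcs (Q n) \<Longrightarrow> (Q_flip n f u, Q_flip n f v) \<in> parcs (Q n)"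
  by (cases u; cases v) (auto simp: Q_flip_def Q_arc_iff add_mod_2_eq_iff)

lemma Q_flip_is_graph_iso: "is_graph_iso (Q n) (Q n) (Q_flip n f)"
  by (rule is_graph_isoI_inverse[where g = "Q_flip n f"])
    (simp_all add: Q_flip_verts Q_flip_involution Q_flip_arc)

lemma Q_is_vertex_transitive:
  assumes n_ge_3: "n \<ge> 3"
  shows "is_vertex_transitive (Q n)"
proof -
  interpret pair_graph "Q n"
    using n_ge_3 by (rule Q_pair_graph)
  show ?thesis
  proof (rule is_vertex_transitiveI)
    fix s t assume "s \<in> pverts (Q n)" "t \<in> pverts (Q n)"
    then obtain i x y j u v where s: "s = (i, x, y)" "i < n" "x < 2" "y < 2"
        and t: "t = (j, u, v)" "j < n" "u < 2" "v < 2"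
      by (cases s; cases t) (auto simp: Q_verts_iff)
    define f where "f k = (if k = j then x + u else y + v)" for k
    have "i + (j + n - i) = j + n"
      using s(2) by simp
    then have "Q_rotate n (j + n - i) s = (j, x, y)"
      using s t(2) by (simp add: Q_rotate_def)
    moreover have "cyc_succ n j \<noteq> j"
      using n_ge_3 cyc_succ_neq(1)[OF t(2)] by simp
    moreover have "(a + (a + b)) mod 2 = b" if "b < 2" for a b :: nat
      using that by presburger
    ultimately have "(Q_flip n f \<circ> Q_rotate n (j + n - i)) s = t"
      using t by (simp add: Q_flip_def f_def)
    moreover have "is_graph_iso (Q n) (Q n) (Q_flip n f \<circ> Q_rotate n (j + n - i))"
      using Q_rotate_is_graph_iso Q_flip_is_graph_iso by (rule is_graph_iso_comp)
    ultimately show "\<exists>h. is_graph_iso (Q n) (Q n) h \<and> h s = t"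
      by blast
  qed
qed

lemma Q_in_diamond_same_layer:
  assumes n_ge_4: "n \<ge> 4" and "in_diamond (Q n) u v"
  shows "fst u = fst v"
proof -
  obtain s t where st: "s \<noteq> t" "(s, t) \<notin> parcs (Q n)" and arc: "(u, v) \<in> parcs (Q n)"
      and common: "{(u, s), (v, s), (u, t), (v, t)} \<subseteq> parcs (Q n)"
    using assms(2) unfolding in_diamond_def by blast
  have not_consecutive: "fst b \<noteq> cyc_succ n (fst a)"
    if ab: "(a, b) \<in> parcs (Q n)" "{(a, s), (b, s), (a, t), (b, t)} \<subseteq> parcs (Q n)" for a b
  proof
    assume succ: "fst b = cyc_succ n (fst a)"
    obtain i x y z where a: "a = (i, x, y)" and b: "b = (cyc_succ n i, y, z)"
        and bounds: "i < n" "y < 2"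
      using n_ge_4 ab(1) succ by (elim Q_consecutive_arcE[rotated]) simp_all
    have "s \<in> Q_junction n i y" "t \<in> Q_junction n i y"
      using ab Q_common_neighbour_mem_junction[OF n_ge_4, of i x y _ z] by (simp_all add: a b)
    then show False
      using Q_junction_is_clique[OF bounds] st by (auto simp: is_clique_def)
  qed
  have "fst v \<noteq> cyc_succ n (fst u)"
    using arc common by (intro not_consecutive) auto
  moreover have "fst u \<noteq> cyc_succ n (fst v)"
    using arc common by (intro not_consecutive) (auto simp: Q_arc_sym)
  ultimately show ?thesis
    using Q_arc_layers[OF arc] by (auto simp: cyc_adjacent_def)
qed

lemma Q_in_diamond_fst_bit:
  assumes n_ge_3: "n \<ge> 3" and "i < n" "x < 2" "x' < 2" "y < 2" "x \<noteq> x'"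
  shows "in_diamond (Q n) (i, x, y) (i, x', y)"
proof -
  have "cyc_succ n i \<noteq> i" "cyc_succ n (cyc_succ n i) \<noteq> i"
    using n_ge_3 cyc_succ_neq[OF assms(2)] by simp_all
  moreover have "1 - y \<noteq> y" "1 - y < 2"
    using assms(5) by presburger+
  ultimately show ?thesis
    using assms cyc_succ_less[OF assms(2)] unfolding in_diamond_def
    by (intro conjI bexI[of _ "(i, 0, 1 - y)"] bexI[of _ "(cyc_succ n i, y, 0)"])
      (auto simp: Q_arc_iff Q_verts_iff)
qed

lemma Q_in_diamond_snd_bit:
  assumes n_ge_3: "n \<ge> 3" and "i < n" "x < 2" "y < 2" "y' < 2" "y \<noteq> y'"
  shows "in_diamond (Q n) (i, x, y) (i, x, y')"
proof -
  obtain j where j: "j < n" and prev_iff: "\<And>k. k < n \<Longrightarrow> i = cyc_succ n k \<longleftrightarrow> k = j"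
    using assms(2) by (rule cyc_pred_unique) blast
  have "j \<noteq> i" "j \<noteq> cyc_succ n i" "i \<noteq> cyc_succ n i"
    using n_ge_3 prev_iff[OF j] cyc_succ_neq[OF j] cyc_succ_neq[OF assms(2)] by auto
  moreover have "1 - x \<noteq> x" "1 - x < 2"
    using assms(3) by presburger+
  ultimately show ?thesis
    using assms j prev_iff[OF j] unfolding in_diamond_def
    by (intro conjI bexI[of _ "(i, 1 - x, 0)"] bexI[of _ "(j, 0, x)"])
      (auto simp: Q_arc_iff Q_verts_iff)
qed

lemma Q_automorphism_preserves_layers:
  assumes n_ge_4: "n \<ge> 4" and h: "is_graph_iso (Q n) (Q n) h"
    and uv: "u \<in> pverts (Q n)" "v \<in> pverts (Q n)" "fst u = fst v"
  shows "fst (h u) = fst (h v)"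
proof -
  have diamond: "fst (h s) = fst (h t)"
    if "s \<in> pverts (Q n)" "t \<in> pverts (Q n)" "s \<noteq> t \<Longrightarrow> in_diamond (Q n) s t" for s t
    using that is_graph_iso_in_diamond[OF h, of s t] Q_in_diamond_same_layer[OF n_ge_4]
    by (cases "s = t") auto
  obtain i x y x' y' where u: "u = (i, x, y)" and v: "v = (i, x', y')"
      and bounds: "i < n" "x < 2" "y < 2" "x' < 2" "y' < 2"
    using uv by (cases u; cases v) (auto simp: Q_verts_iff)
  have "fst (h (i, x, y)) = fst (h (i, x', y))"
    using n_ge_4 bounds by (intro diamond) (auto simp: Q_verts_iff intro: Q_in_diamond_fst_bit)
  also have "\<dots> = fst (h (i, x', y'))"
    using n_ge_4 bounds by (intro diamond) (auto simp: Q_verts_iff intro: Q_in_diamond_snd_bit)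
  finally show ?thesis
    by (simp add: u v)
qed

section \<open>Q as a Cayley graph\<close>

lemma cayley_graph_left_mult_iso:
  fixes G (structure)
  assumes "group G" and k: "k \<in> carrier G"
  shows "is_graph_iso (cayley_graph G S) (cayley_graph G S) (\<lambda>g. k \<otimes> g)"
proof -
  interpret group G by fact
  have arc: "(a \<otimes> g, a \<otimes> h) \<in> parcs (cayley_graph G S)"
    if "(g, h) \<in> parcs (cayley_graph G S)" "a \<in> carrier G" for a g h
  proof -
    have gh: "g \<in> carrier G" "h \<in> carrier G" "inv g \<otimes> h \<in> S"
      using that(1) by (simp_all add: cayley_graph_def)
    have "inv (a \<otimes> g) \<otimes> (a \<otimes> h) = inv g \<otimes> (inv a \<otimes> a) \<otimes> h"
      using gh that(2) by (simp only: inv_mult_group m_assoc m_closed inv_closed)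
    then show ?thesis
      using gh that(2) by (simp add: cayley_graph_def)
  qed
  show ?thesis
    by (rule is_graph_isoI_inverse[where g = "\<lambda>g. inv k \<otimes> g"])
      (use k arc in \<open>auto simp: cayley_graph_def simp flip: m_assoc\<close>)
qed

locale Q_cayley_labelling = group G for G (structure) +
  fixes S :: "'a set" and n :: nat and \<psi> :: "'a \<Rightarrow> nat \<times> nat \<times> nat"
  assumes n_ge_4: "n \<ge> 4" and iso: "is_graph_iso (cayley_graph G S) (Q n) \<psi>"
begin

definition layer :: "'a \<Rightarrow> nat" where
  "layer g = fst (\<psi> g)"

definition fst_bit :: "'a \<Rightarrow> nat" where
  "fst_bit g = fst (snd (\<psi> g))"

definition snd_bit :: "'a \<Rightarrow> nat" where
  "snd_bit g = snd (snd (\<psi> g))"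

lemma \<psi>_bij: "bij_betw \<psi> (carrier G) (pverts (Q n))"
  using iso by (simp add: is_graph_iso_def cayley_graph_def)

lemma layer_less: "g \<in> carrier G \<Longrightarrow> layer g < n"
  and fst_bit_less: "g \<in> carrier G \<Longrightarrow> fst_bit g < 2"
  and snd_bit_less: "g \<in> carrier G \<Longrightarrow> snd_bit g < 2"
  using bij_betwE[OF \<psi>_bij]
  by (auto simp: layer_def fst_bit_def snd_bit_def Q_def)

lemma \<psi>_eq: "\<psi> g = (layer g, fst_bit g, snd_bit g)"
  by (simp add: layer_def fst_bit_def snd_bit_def)

lemma exists_with_coordinates:
  assumes "i < n" "x < 2" "y < 2"
  shows "\<exists>g\<in>carrier G. layer g = i \<and> fst_bit g = x \<and> snd_bit g = y"
proof -
  have "(i, x, y) \<in> \<psi> ` carrier G"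
    using assms \<psi>_bij by (simp add: bij_betw_def Q_verts_iff)
  then show ?thesis
    by (auto simp: \<psi>_eq)
qed

lemma arc_consecutive_iff:
  assumes gh: "g \<in> carrier G" "h \<in> carrier G" and "layer h = cyc_succ n (layer g)"
  shows "(\<psi> g, \<psi> h) \<in> parcs (Q n) \<longleftrightarrow> snd_bit g = fst_bit h"
proof -
  have "cyc_succ n (layer g) \<noteq> layer g" "cyc_succ n (cyc_succ n (layer g)) \<noteq> layer g"
    using n_ge_4 cyc_succ_neq[OF layer_less[OF gh(1)]] by simp_all
  then show ?thesis
    using assms layer_less[OF gh(2)]
    by (auto simp: \<psi>_eq Q_arc_iff layer_less fst_bit_less snd_bit_less)
qed

lemma order_eq: "order G = 4 * n"
  using bij_betw_same_card[OF \<psi>_bij] by (simp add: order_def card_Q_verts)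

lemma finite_carrier: "finite (carrier G)"
  using bij_betw_finite[OF \<psi>_bij] finite_Q_verts by blast

lemma arc_left_mult:
  assumes "k \<in> carrier G" "g \<in> carrier G" "h \<in> carrier G"
  shows "(\<psi> (k \<otimes> g), \<psi> (k \<otimes> h)) \<in> parcs (Q n) \<longleftrightarrow> (\<psi> g, \<psi> h) \<in> parcs (Q n)"
  using assms iso cayley_graph_left_mult_iso[OF is_group assms(1), of S]
  by (simp add: is_graph_iso_def cayley_graph_def)

lemma layer_left_mult:
  assumes k: "k \<in> carrier G" and gh: "g \<in> carrier G" "h \<in> carrier G" and eq: "layer g = layer h"
  shows "layer (k \<otimes> g) = layer (k \<otimes> h)"
proof -
  define \<phi> where "\<phi> = inv_into (carrier G) \<psi>"
  have "is_graph_iso (Q n) (cayley_graph G S) \<phi>"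
    using is_graph_iso_inv_into[OF iso] by (simp add: \<phi>_def cayley_graph_def)
  then have "is_graph_iso (Q n) (Q n) (\<psi> \<circ> ((\<lambda>g. k \<otimes> g) \<circ> \<phi>))"
    using cayley_graph_left_mult_iso[OF is_group k] iso by (blast intro: is_graph_iso_comp)
  moreover have "\<psi> g \<in> pverts (Q n)" "\<psi> h \<in> pverts (Q n)"
    using \<psi>_bij gh by (auto dest: bij_betwE)
  moreover have "fst (\<psi> g) = fst (\<psi> h)"
    using eq by (simp add: layer_def)
  ultimately have "fst ((\<psi> \<circ> ((\<lambda>g. k \<otimes> g) \<circ> \<phi>)) (\<psi> g)) = fst ((\<psi> \<circ> ((\<lambda>g. k \<otimes> g) \<circ> \<phi>)) (\<psi> h))"
    using Q_automorphism_preserves_layers[OF n_ge_4] by blast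
  moreover have "\<phi> (\<psi> g) = g" "\<phi> (\<psi> h) = h"
    using bij_betw_inv_into_left[OF \<psi>_bij] gh by (simp_all add: \<phi>_def)
  ultimately show ?thesis
    by (simp add: layer_def)
qed

lemma layer_left_mult_iff:
  assumes "k \<in> carrier G" "g \<in> carrier G" "h \<in> carrier G"
  shows "layer (k \<otimes> g) = layer (k \<otimes> h) \<longleftrightarrow> layer g = layer h"
proof
  assume "layer (k \<otimes> g) = layer (k \<otimes> h)"
  then have "layer (inv k \<otimes> (k \<otimes> g)) = layer (inv k \<otimes> (k \<otimes> h))"
    using assms by (intro layer_left_mult[of "inv k"]) simp_all
  then show "layer g = layer h"
    using assms by (simp flip: m_assoc)
qed (use assms layer_left_mult in blast)

lemma cyc_adjacent_layer_left_mult: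
  assumes k: "k \<in> carrier G" and gh: "g \<in> carrier G" "h \<in> carrier G"
    and adj: "cyc_adjacent n (layer g) (layer h)"
  shows "cyc_adjacent n (layer (k \<otimes> g)) (layer (k \<otimes> h))"
proof -
  have less: "layer g < n" "layer h < n"
    using gh by (simp_all add: layer_less)
  obtain g' where g': "g' \<in> carrier G" "layer g' = layer g" "fst_bit g' = 0" "snd_bit g' = 0"
    using exists_with_coordinates[OF less(1), of 0 0] by auto
  obtain h' where h': "h' \<in> carrier G" "layer h' = layer h" "fst_bit h' = 0" "snd_bit h' = 0"
    using exists_with_coordinates[OF less(2), of 0 0] by auto
  have "(\<psi> g', \<psi> h') \<in> parcs (Q n)"
    using adj less g' h' by (auto simp: \<psi>_eq Q_arc_iff cyc_adjacent_def)
  then have "(\<psi> (k \<otimes> g'), \<psi> (k \<otimes> h')) \<in> parcs (Q n)"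
    using arc_left_mult k g'(1) h'(1) by simp
  then have "layer (k \<otimes> g') = layer (k \<otimes> h') \<or> cyc_adjacent n (layer (k \<otimes> g')) (layer (k \<otimes> h'))"
    using Q_arc_layers by (auto simp: layer_def)
  moreover have "cyc_succ n (layer g) \<noteq> layer g"
    using n_ge_4 cyc_succ_neq(1)[OF less(1)] by simp
  with adj have "layer g \<noteq> layer h"
    unfolding cyc_adjacent_def by metis
  then have "layer (k \<otimes> g') \<noteq> layer (k \<otimes> h')"
    using layer_left_mult_iff[OF k g'(1) h'(1)] g'(2) h'(2) by simp
  moreover have "layer (k \<otimes> g') = layer (k \<otimes> g)" "layer (k \<otimes> h') = layer (k \<otimes> h)"
    using layer_left_mult[OF k g'(1) gh(1) g'(2)] layer_left_mult[OF k h'(1) gh(2) h'(2)]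
    by simp_all
  ultimately show ?thesis by simp
qed

definition base_layer :: "'a set" where
  "base_layer = {g \<in> carrier G. layer g = layer \<one>}"

lemma subgroup_base_layer: "subgroup base_layer G"
proof (rule subgroupI)
  fix g assume "g \<in> base_layer"
  then have g: "g \<in> carrier G" "layer g = layer \<one>"
    by (simp_all add: base_layer_def)
  then have "layer (inv g \<otimes> g) = layer (inv g \<otimes> \<one>)"
    by (intro layer_left_mult) auto
  with g show "inv g \<in> base_layer"
    by (simp add: base_layer_def)
next
  fix g h assume "g \<in> base_layer" "h \<in> base_layer"
  then have gh: "g \<in> carrier G" "h \<in> carrier G" "layer g = layer \<one>" "layer h = layer \<one>"
    by (simp_all add: base_layer_def)
  then have "layer (g \<otimes> h) = layer (g \<otimes> \<one>)"
    by (intro layer_left_mult) auto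
  with gh show "g \<otimes> h \<in> base_layer"
    by (simp add: base_layer_def)
qed (auto simp: base_layer_def)

lemma card_base_layer: "card base_layer = 4"
proof -
  have "Q_layer (layer \<one>) \<subseteq> \<psi> ` base_layer"
  proof
    fix v assume v: "v \<in> Q_layer (layer \<one>)"
    then have "v \<in> pverts (Q n)"
      using layer_less[OF one_closed] by (auto simp: Q_layer_def Q_verts_iff)
    then obtain g where "g \<in> carrier G" "v = \<psi> g"
      using \<psi>_bij by (auto simp: bij_betw_def)
    with v show "v \<in> \<psi> ` base_layer"
      by (auto simp: base_layer_def layer_def Q_layer_def)
  qed
  moreover have "\<psi> ` base_layer \<subseteq> Q_layer (layer \<one>)"
    using fst_bit_less snd_bit_less by (auto simp: base_layer_def \<psi>_eq Q_layer_def)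
  ultimately have "\<psi> ` base_layer = Q_layer (layer \<one>)"
    by blast
  moreover have "inj_on \<psi> base_layer"
    using \<psi>_bij by (auto simp: bij_betw_def base_layer_def intro: inj_on_subset)
  ultimately show ?thesis
    using card_image card_Q_layer by metis
qed

lemma inj_on_layer_odd_subgroup:
  assumes P: "subgroup P G" "odd (card P)"
  shows "inj_on layer P"
proof (rule inj_onI)
  fix p q assume pq: "p \<in> P" "q \<in> P" and eq: "layer p = layer q"
  have carrier: "p \<in> carrier G" "q \<in> carrier G"
    using P(1) pq by (auto intro: subgroup.mem_carrier)
  have "coprime (card base_layer) (card P)"
    using P(2) coprime_power_left_iff[of 2 2 "card P"] by (simp add: card_base_layer)
  then have trivial: "base_layer \<inter> P = {\<one>}"
    using subgroup_base_layer P(1) by (intro coprime_subgroups_inter)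
  have "layer (inv p \<otimes> q) = layer (inv p \<otimes> p)"
    using carrier eq by (intro layer_left_mult) auto
  then have "inv p \<otimes> q \<in> base_layer \<inter> P"
    using carrier pq P(1) by (simp add: base_layer_def subgroup.m_closed subgroup.m_inv_closed)
  with trivial carrier show "p = q"
    by (metis inv_equality inv_inv inv_closed singletonD)
qed

context
  fixes P r
  assumes P: "P \<lhd> G" "odd (card P)" and r: "r \<in> P" "layer r = cyc_succ n (layer \<one>)"
begin

lemma subgroup_P: "subgroup P G"
  using P(1) by (rule normal_imp_subgroup)

lemma shift_closed: "r \<in> carrier G" "inv r \<in> P"
  using r(1) subgroup_P by (auto intro: subgroup.mem_carrier subgroup.m_inv_closed)

lemma layer_shift:
  assumes "h \<in> base_layer"
  shows "layer (r \<otimes> h) = cyc_succ n (layer \<one>)"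
  using layer_left_mult[of r h \<one>] assms r(2) shift_closed(1) by (simp add: base_layer_def)

lemma layer_inv_shift: "layer \<one> = cyc_succ n (layer (inv r))"
proof -
  have "cyc_adjacent n (layer (inv r \<otimes> \<one>)) (layer (inv r \<otimes> r))"
    using r(2) shift_closed by (intro cyc_adjacent_layer_left_mult) (auto simp: cyc_adjacent_def)
  moreover have "layer (inv r) \<noteq> layer r"
  proof
    assume "layer (inv r) = layer r"
    then have "inv r = r"
      using inj_onD[OF inj_on_layer_odd_subgroup[OF subgroup_P P(2)]] r(1) shift_closed(2) by blast
    then have "r \<otimes> r = \<one>"
      using r_inv[OF shift_closed(1)] by simp
    then have "r = \<one>"
      using odd_subgroup_no_involution[OF subgroup_P P(2) r(1)] by simp
    then show False
      using r(2) n_ge_4 cyc_succ_neq(1)[OF layer_less[OF one_closed]] by simp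
  qed
  ultimately show ?thesis
    using r(2) shift_closed(1) by (simp add: cyc_adjacent_def)
qed

lemma conj_shift:
  assumes h: "h \<in> base_layer"
  shows "inv h \<otimes> r \<otimes> h \<in> {r, inv r}"
proof -
  have h_closed: "h \<in> carrier G" and h_layer: "layer h = layer \<one>"
    using h by (simp_all add: base_layer_def)
  have "cyc_adjacent n (layer h) (layer (r \<otimes> h))"
    using layer_shift[OF h] h_layer by (simp add: cyc_adjacent_def)
  then have "cyc_adjacent n (layer (inv h \<otimes> h)) (layer (inv h \<otimes> (r \<otimes> h)))"
    using shift_closed(1) h_closed by (intro cyc_adjacent_layer_left_mult) auto
  then have "cyc_adjacent n (layer \<one>) (layer (inv h \<otimes> r \<otimes> h))"
    using shift_closed(1) h_closed by (simp add: m_assoc)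
  moreover have conj: "inv h \<otimes> r \<otimes> h \<in> P"
    using normal.inv_op_closed1[OF P(1) h_closed r(1)] .
  moreover have "layer (inv r) < n" "layer (inv h \<otimes> r \<otimes> h) < n"
    using shift_closed(1) h_closed by (simp_all add: layer_less)
  ultimately have "layer (inv h \<otimes> r \<otimes> h) = layer r \<or> layer (inv h \<otimes> r \<otimes> h) = layer (inv r)"
    using r(2) layer_inv_shift cyc_succ_eq_iff unfolding cyc_adjacent_def by metis
  then show ?thesis
    using inj_onD[OF inj_on_layer_odd_subgroup[OF subgroup_P P(2)]] conj r(1) shift_closed(2)
    by blast
qed

lemma arc_shift_iff:
  assumes h: "h \<in> base_layer"
  shows "(\<psi> h, \<psi> (r \<otimes> h)) \<in> parcs (Q n) \<longleftrightarrow> (\<psi> \<one>, \<psi> r) \<in> parcs (Q n)"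
proof -
  have h_closed: "h \<in> carrier G"
    using h by (simp add: base_layer_def)
  have "(\<psi> h, \<psi> (r \<otimes> h)) \<in> parcs (Q n) \<longleftrightarrow> (\<psi> \<one>, \<psi> (inv h \<otimes> r \<otimes> h)) \<in> parcs (Q n)"
    using arc_left_mult[of "inv h" h "r \<otimes> h"] h_closed shift_closed(1) by (simp add: m_assoc)
  moreover have "(\<psi> \<one>, \<psi> (inv r)) \<in> parcs (Q n) \<longleftrightarrow> (\<psi> \<one>, \<psi> r) \<in> parcs (Q n)"
    using arc_left_mult[of r \<one> "inv r"] shift_closed(1) Q_arc_sym[of "\<psi> r" "\<psi> \<one>"] by simp
  ultimately show ?thesis
    using conj_shift[OF h] by auto
qed

lemma fst_bit_shift_eq:
  assumes h: "h \<in> base_layer" and bits: "snd_bit h = snd_bit \<one>"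
  shows "fst_bit (r \<otimes> h) = fst_bit r"
proof -
  have h_closed: "h \<in> carrier G" and h_layer: "layer h = layer \<one>"
    using h by (simp_all add: base_layer_def)
  have "snd_bit \<one> = fst_bit (r \<otimes> h) \<longleftrightarrow> (\<psi> h, \<psi> (r \<otimes> h)) \<in> parcs (Q n)"
    using arc_consecutive_iff[of h "r \<otimes> h"] h_closed h_layer layer_shift[OF h] bits shift_closed(1)
    by simp
  also have "\<dots> \<longleftrightarrow> (\<psi> \<one>, \<psi> r) \<in> parcs (Q n)"
    using h by (rule arc_shift_iff)
  also have "\<dots> \<longleftrightarrow> snd_bit \<one> = fst_bit r"
    using r(2) shift_closed(1) by (intro arc_consecutive_iff) simp_all
  finally show ?thesis
    using snd_bit_less[of \<one>] fst_bit_less[of r] fst_bit_less[of "r \<otimes> h"]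
      shift_closed(1) h_closed
    by force
qed

lemma fst_bit_eq_if_shift_eq:
  assumes h: "h \<in> base_layer" and bits: "fst_bit (r \<otimes> h) = fst_bit r"
  shows "fst_bit h = fst_bit \<one>"
proof -
  have h_closed: "h \<in> carrier G" and h_layer: "layer h = layer \<one>"
    using h by (simp_all add: base_layer_def)
  obtain t where t: "t \<in> carrier G" "layer t = layer \<one>" "snd_bit t = fst_bit r"
    using exists_with_coordinates[OF layer_less _ fst_bit_less, of \<one> 0 r] shift_closed(1) by auto
  have "(\<psi> t, \<psi> r) \<in> parcs (Q n)" "(\<psi> t, \<psi> (r \<otimes> h)) \<in> parcs (Q n)"
    using arc_consecutive_iff t r(2) shift_closed(1) h_closed layer_shift[OF h] bits by simp_all
  then have arcs: "(\<psi> (inv r \<otimes> t), \<psi> \<one>) \<in> parcs (Q n)" "(\<psi> (inv r \<otimes> t), \<psi> h) \<in> parcs (Q n)"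
    using arc_left_mult[of "inv r" t r] arc_left_mult[of "inv r" t "r \<otimes> h"]
      shift_closed(1) h_closed t(1)
    by (simp_all flip: m_assoc)
  have "layer \<one> = cyc_succ n (layer (inv r \<otimes> t))"
    using layer_left_mult[of "inv r" t \<one>] layer_inv_shift shift_closed(1) t by simp
  then have "snd_bit (inv r \<otimes> t) = fst_bit \<one>" "snd_bit (inv r \<otimes> t) = fst_bit h"
    using arcs arc_consecutive_iff shift_closed(1) t(1) h_closed h_layer by simp_all
  then show ?thesis by simp
qed

end

lemma layer_image_odd_subgroup:
  assumes P: "subgroup P G" "card P = n" and "odd n"
  shows "layer ` P = {..<n}"
proof (rule card_subset_eq)
  show "layer ` P \<subseteq> {..<n}"
    using subgroup.mem_carrier[OF P(1)] layer_less by auto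
  show "card (layer ` P) = card {..<n}"
    using inj_on_layer_odd_subgroup[OF P(1)] assms by (simp add: card_image)
qed simp

lemma even_if_normal_subgroup_of_card_n:
  assumes P: "P \<lhd> G" "card P = n"
  shows "even n"
proof (rule ccontr)
  assume odd: "odd n"
  have "cyc_succ n (layer \<one>) < n"
    by (intro cyc_succ_less layer_less one_closed)
  then obtain r where r: "r \<in> P" "layer r = cyc_succ n (layer \<one>)"
    using layer_image_odd_subgroup[OF normal_imp_subgroup[OF P(1)] P(2) odd]
    by (metis imageE lessThan_iff)
  note shift = P(1) _ r
  have "fst_bit \<one> < 2"
    by (intro fst_bit_less one_closed)
  then have "1 - fst_bit \<one> < 2" "1 - fst_bit \<one> \<noteq> fst_bit \<one>"
    by presburger+
  moreover from this obtain h where h: "h \<in> carrier G" "layer h = layer \<one>"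
      "fst_bit h = 1 - fst_bit \<one>" "snd_bit h = snd_bit \<one>"
    using exists_with_coordinates[OF layer_less _ snd_bit_less] one_closed by blast
  moreover have "h \<in> base_layer"
    using h by (simp add: base_layer_def)
  ultimately show False
    using fst_bit_shift_eq[OF shift] fst_bit_eq_if_shift_eq[OF shift] P(2) odd by simp
qed

lemma not_prime: "\<not> prime n"
proof
  assume p: "prime n"
  have "odd n"
    using p n_ge_4 by (auto dest: prime_odd_nat)
  then have "n > 4"
    using n_ge_4 by (cases "n = 4") auto
  obtain P where P: "subgroup P G" "card P = n"
    using sylow_thm[OF p is_group, of 1 4] order_eq finite_carrier by (auto simp: mult.commute)
  have "order G < card P * card P"
    using \<open>n > 4\<close> by (simp add: order_eq P(2))
  then have "P \<lhd> G"
    using P p finite_carrier by (intro prime_order_subgroup_normal) simp_all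
  then show False
    using even_if_normal_subgroup_of_card_n P(2) \<open>odd n\<close> by blast
qed

end

lemma Q_not_cayley:
  assumes n_ge_4: "n \<ge> 4" and p: "prime n"
  shows "\<not> is_cayley TYPE('g) (Q n)"
proof
  assume "is_cayley TYPE('g) (Q n)"
  then obtain G :: "'g monoid" and S where G: "group G"
      and iso: "digraph_iso (with_proj (Q n)) (with_proj (cayley_graph G S))"
    unfolding is_cayley_def by blast
  obtain \<psi> where "is_graph_iso (cayley_graph G S) (Q n) \<psi>"
    using digraph_iso_with_proj_imp_is_graph_iso[OF iso] is_graph_iso_inv_into by blast
  then interpret Q_cayley_labelling G S n \<psi>
    using G n_ge_4 by (simp add: Q_cayley_labelling_def Q_cayley_labelling_axioms_def)
  show False
    using not_prime p by blast
qed

theorem proposition3p5: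
  fixes n :: nat
  assumes "n \<ge> 4"
  shows "Digraph_Component.connected (with_proj (Q n))
    \<and> is_vertex_transitive (Q n)
    \<and> is_CIS (Q n)
    \<and> card (pverts (Q n)) = 4 * n
    \<and> has_valency (Q n) 7
    \<and> stability_number (Q n) = n
    \<and> clique_number (Q n) = 4
    \<and> (prime n \<longrightarrow> \<not> is_cayley TYPE('g) (Q n))"
proof -
  have "n \<ge> 3"
    using assms by simp
  show ?thesis
    using Q_connected[OF \<open>n \<ge> 3\<close>] Q_is_vertex_transitive[OF \<open>n \<ge> 3\<close>] Q_is_CIS[OF assms]
      card_Q_verts[of n] Q_has_valency[OF \<open>n \<ge> 3\<close>] Q_stability_number[of n]
      Q_clique_number[OF assms] Q_not_cayley[OF assms, where 'g = 'g]
    by simp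
qed

end
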